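(* Let $n\geq1$, let $A\in\mathbb{M}_n(\mathbb{R})$ be a connected unidiagonal triangle-integral matrix, and let $s\in\{0,1,2,3\}$ be an arbitrary fixed strategy. Then: (a) the pessimistic (worst-case) complexity of Algorithm PosDefTestByInflations$(A,s)$ is $O(n^4)$; (b) the pessimistic (worst-case) complexity of Algorithm PosDefTestByRootInflations$(A,s)$ is $O(n^3)$. Here the algorithms are: PosDefTestByInflations$(A,s)$: set $\Delta:=\Delta(A)$; set $D:=$ InflationsAtPairPos$(\Delta,s)$; return true if $D$ is a Dynkin graph, false otherwise. PosDefTestByRootInflations$(A,s)$: set $\Delta:=\Delta(A)$; set $\hat\Delta:=$ InflationsToPosSincereRoot$(\Delta)$; set $D:=$ InflationsAtPairPoss$(\hat\Delta,s)$; return true if $D$ is a Dynkin graph, false otherwise.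
   Context: For $A=[a_{ij}]\in\mathbb{M}_n(\mathbb{R})$, $\nabla(A)$ is the upper triangular matrix with entries $a_{ij}+a_{ji}$ ($i<j$), $a_{ii}$ on the diagonal and $0$ below. $A$ is unidiagonal if its diagonal entries are all $1$ and triangle-integral if $\nabla(A)$ is integral. A loop-free bigraph on $\{1,\dots,n\}$ (loopless multigraph with solid and dotted edges, two vertices joined by edges of only one kind) is encoded by integers $d_{ij}=d_{ji}$: $-m$ for $m$ solid edges, $+m$ for $m$ dotted edges; its Gram matrix is upper triangular with $1$'s on the diagonal and $d_{ij}$ at $(i,j)$, $i<j$. $\Delta(A)$ is the bigraph with $d_{ij}$ equal to the $(i,j)$ entry of $\nabla(A)$ for $i<j$; $A$ is connected if the underlying graph of $\Delta(A)$ is connected. Inflation at vertex $a$: $d'_{ac}=-d_{ac}$ ($c\ne a$). Inflation at pair $(a,b)$, defined iff $d_{ab}>0$: $d'_{ab}=-d_{ab}$, $d'_{bc}=d_{bc}-d_{ac}d_{ab}$ ($c\neq a,b$), others unchanged. A Dynkin graph is a bigraph with all $d_{ij}\in\{0,-1\}$ whose underlying simple graph is one of the Dynkin diagrams $\mathbb{A}_n$ ($n\ge1$), $\mathbb{D}_n$ ($n\ge4$), $\mathbb{E}_6,\mathbb{E}_7,\mathbb{E}_8$. InflationsAtPair$(\Delta,s)$: while $\Delta$ has a dotted edge, select a dotted edge $a\cdots b$ according to strategy $s$ and set $\Delta:=\mathrm{infl}_{a,b}\Delta$; finally return $D:=\Delta$. Strategies: $s=0$: the dotted edge $(a,b)$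 smallest in lexicographic order among dotted edges; $s=1$: the lexicographically greatest; $s=2$: randomly the first or the last; $s=3$: a random dotted edge. InflationsAtPairPos (resp. InflationsAtPairPoss) works as InflationsAtPair but stops the loop after $\mu(n)$ (resp. $\mu'(n)$) inflations, where $\mu(n)=\frac12(n^2-n)$ for $n\in\{1,2,3\}$, $\mu(6)=30$, $\mu(7)=56$, $\mu(8)=112$, $\mu(n)=n^2-2n$ otherwise; $\mu'(n)=0$ for $n\in\{1,2,3\}$, $\mu'(6)=5$, $\mu'(7)=10$, $\mu'(8)=21$, $\mu'(n)=n-3$ otherwise. InflationsToPosSincereRoot$(\Delta)$: set $S:=\{1\}$; while $|S|<n$: choose $(a,b)\in S\times(\{1,\dots,n\}\setminus S)$ with $d_{ab}\neq0$; if $d_{ab}<0$ set $\Delta:=\mathrm{infl}_b\Delta$; set $\Delta:=\mathrm{infl}_{b,a}\Delta$; set $S:=S\cup\{b\}$; return $\Delta$. Complexity is counted as the number of arithmetic operations performed on the coefficients of the Gram matrix of the current bigraph. *)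

theory Defs
  imports
    "Jordan_Normal_Form.Matrix"
    "HOL-Library.Monad_Syntax"
    "HOL-Library.Extended_Nat"
    "HOL-Library.Landau_Symbols"
begin

section \<open>Matrices and bigraphs\<close>

text \<open>
  Indices of matrices and vertices of bigraphs run through \<open>{..<n}\<close> instead of \<open>{1..n}\<close>.
  A loop-free bigraph on \<open>n\<close> vertices is represented by its Gram matrix, an upper triangular
  integer matrix with diagonal entries \<open>1\<close>; the number of vertices is its dimension.
\<close>

definition nabla :: "real mat \<Rightarrow> real mat" where
  "nabla A = mat (dim_row A) (dim_row A)
     (\<lambda>(i, j). if i < j then A $$ (i, j) + A $$ (j, i) else if i = j then A $$ (i, i) else 0)"

definition unidiagonal :: "real mat \<Rightarrow> bool" where
  "unidiagonal A \<longleftrightarrow> (\<forall>i < dim_row A. A $$ (i, i) = 1)"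

definition triangle_integral :: "real mat \<Rightarrow> bool" where
  "triangle_integral A \<longleftrightarrow> (\<forall>i < dim_row A. \<forall>j < dim_row A. nabla A $$ (i, j) \<in> \<int>)"

text \<open>The floor only changes the type: it is applied to integers if \<open>A\<close> is triangle-integral.\<close>

definition bigraph_of :: "real mat \<Rightarrow> int mat" where
  "bigraph_of A = mat (dim_row A) (dim_row A)
     (\<lambda>(i, j). if i < j then \<lfloor>nabla A $$ (i, j)\<rfloor> else if i = j then 1 else 0)"

text \<open>
  \<open>coef G i j\<close> is the integer \<open>d\<^sub>i\<^sub>j = d\<^sub>j\<^sub>i\<close>, for \<open>i \<noteq> j\<close>.  Both orders of the
  two vertices refer to the same entry of the Gram matrix.
\<close>

definition coef :: "int mat \<Rightarrow> nat \<Rightarrow> nat \<Rightarrow> int" where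
  "coef G i j = G $$ (min i j, max i j)"

definition set_coef :: "nat \<Rightarrow> nat \<Rightarrow> int \<Rightarrow> int mat \<Rightarrow> int mat" where
  "set_coef i j x G = update_mat G (min i j, max i j) x"

definition adjacency :: "int mat \<Rightarrow> (nat \<times> nat) set" where
  "adjacency G =
     {(i, j). i < dim_row G \<and> j < dim_row G \<and> i \<noteq> j \<and> coef G i j \<noteq> 0}"

definition connected_bigraph :: "int mat \<Rightarrow> bool" where
  "connected_bigraph G \<longleftrightarrow> (\<forall>i < dim_row G. \<forall>j < dim_row G. (i, j) \<in> (adjacency G)\<^sup>*)"

definition connected_matrix :: "real mat \<Rightarrow> bool" where
  "connected_matrix A \<longleftrightarrow> connected_bigraph (bigraph_of A)"

definition infl_vertex :: "nat \<Rightarrow> int mat \<Rightarrow> int mat" where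
  "infl_vertex a G = mat (dim_row G) (dim_row G)
     (\<lambda>(i, j). if i < j \<and> (i = a \<or> j = a) then - G $$ (i, j) else G $$ (i, j))"

text \<open>The inflation at the pair \<open>(a, b)\<close>; it is meaningful only if \<open>coef G a b > 0\<close>.\<close>

definition infl_pair :: "nat \<Rightarrow> nat \<Rightarrow> int mat \<Rightarrow> int mat" where
  "infl_pair a b G = mat (dim_row G) (dim_row G)
     (\<lambda>(i, j).
        if i < j then
          (if {i, j} = {a, b} then - coef G a b
           else if i = b then coef G b j - coef G a j * coef G a b
           else if j = b then coef G b i - coef G a i * coef G a b
           else G $$ (i, j))
        else G $$ (i, j))"

definition path_edges :: "nat \<Rightarrow> nat set set" where
  "path_edges m = {{i, Suc i} | i. Suc i < m}"

text \<open>
  \<open>D\<^sub>n\<close> and \<open>E\<^sub>n\<close> are a path on the vertices \<open>0, \<dots>, n - 2\<close> with the vertex \<open>n - 1\<close>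
  attached to \<open>n - 3\<close> and to \<open>2\<close>, respectively.
\<close>

definition dynkin_diagram :: "nat \<Rightarrow> nat set set \<Rightarrow> bool" where
  "dynkin_diagram n D \<longleftrightarrow>
     (1 \<le> n \<and> D = path_edges n) \<or>
     (4 \<le> n \<and> D = insert {n - 3, n - 1} (path_edges (n - 1))) \<or>
     (n \<in> {6, 7, 8} \<and> D = insert {2, n - 1} (path_edges (n - 1)))"

definition is_dynkin_diagram :: "nat \<Rightarrow> nat set set \<Rightarrow> bool" where
  "is_dynkin_diagram n E \<longleftrightarrow>
     (\<exists>p. bij_betw p {..<n} {..<n} \<and> dynkin_diagram n ((\<lambda>e. p ` e) ` E))"

definition is_dynkin_graph :: "int mat \<Rightarrow> bool" where
  "is_dynkin_graph G \<longleftrightarrow>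
     (\<forall>i j. i < j \<and> j < dim_row G \<longrightarrow> coef G i j \<in> {0, -1}) \<and>
     is_dynkin_diagram (dim_row G) {{i, j} | i j. i < j \<and> j < dim_row G \<and> coef G i j = -1}"


section \<open>Nondeterministic programs with operation counting\<close>

text \<open>
  A program is the set of its possible runs, each given by its result and the number of
  operations performed.  The only primitive with a nonzero cost is \<open>coef_op\<close>: it delivers
  the result of one operation on coefficients, that is, of one addition, subtraction,
  multiplication, negation or comparison.  The primitive \<open>pick\<close> models both the random
  choices and the unspecified choices of the algorithms.
\<close>

datatype 'a prog = Prog (runs: "('a \<times> nat) set")

definition ret :: "'a \<Rightarrow> 'a prog" where
  "ret x = Prog {(x, 0)}"

definition coef_op :: "'a \<Rightarrow> 'a prog" where
  "coef_op x = Prog {(x, 1)}"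

definition pick :: "'a set \<Rightarrow> 'a prog" where
  "pick X = Prog (X \<times> {0})"

definition bind_prog :: "'a prog \<Rightarrow> ('a \<Rightarrow> 'b prog) \<Rightarrow> 'b prog" where
  "bind_prog m f = Prog {(y, s + t) | x y s t. (x, s) \<in> runs m \<and> (y, t) \<in> runs (f x)}"

adhoc_overloading Monad_Syntax.bind \<rightleftharpoons> bind_prog

lemma bind_prog_cong [fundef_cong]:
  assumes "m = m'" and "\<And>x s. (x, s) \<in> runs m' \<Longrightarrow> f x = f' x"
  shows "bind_prog m f = bind_prog m' f'"
  using assms unfolding bind_prog_def by (auto, metis+)

lemma bind_det [simp]:
  "bind_prog (Prog {(x, s)}) f = Prog ((\<lambda>(y, t). (y, s + t)) ` runs (f x))"
  by (force simp: bind_prog_def image_iff)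

primrec foldM :: "('a \<Rightarrow> 'b \<Rightarrow> 'b prog) \<Rightarrow> 'a list \<Rightarrow> 'b \<Rightarrow> 'b prog" where
  "foldM f [] y = ret y"
| "foldM f (x # xs) y = do { z \<leftarrow> f x y; foldM f xs z }"

primrec filterM :: "('a \<Rightarrow> bool prog) \<Rightarrow> 'a list \<Rightarrow> 'a list prog" where
  "filterM P [] = ret []"
| "filterM P (x # xs) =
     do { b \<leftarrow> P x; ys \<leftarrow> filterM P xs; ret (if b then x # ys else ys) }"

lemma foldM_det:
  assumes "\<And>x y. x \<in> set xs \<Longrightarrow> f x y = Prog {(g x y, t x)}"
  shows "foldM f xs y = Prog {(fold g xs y, sum_list (map t xs))}"
  using assms by (induction xs arbitrary: y) (auto simp: ret_def)

lemma filterM_op: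
  "filterM (\<lambda>x. coef_op (P x)) xs = Prog {(filter P xs, length xs)}"
  by (induction xs) (auto simp: ret_def coef_op_def)


section \<open>The algorithms\<close>

text \<open>The pairs \<open>(i, j)\<close> with \<open>i < j < n\<close> in lexicographic order.\<close>

definition vertex_pairs :: "nat \<Rightarrow> (nat \<times> nat) list" where
  "vertex_pairs n = concat (map (\<lambda>i. map (\<lambda>j. (i, j)) [Suc i..<n]) [0..<n])"

definition bigraph_of_prog :: "real mat \<Rightarrow> int mat prog" where
  "bigraph_of_prog A =
     foldM
       (\<lambda>(i, j) G. do { x \<leftarrow> coef_op (A $$ (i, j) + A $$ (j, i)); ret (set_coef i j \<lfloor>x\<rfloor> G) })
       (vertex_pairs (dim_row A)) (1\<^sub>m (dim_row A))"

definition infl_vertex_prog :: "nat \<Rightarrow> int mat \<Rightarrow> int mat prog" where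
  "infl_vertex_prog a G =
     foldM
       (\<lambda>c H. if c = a then ret H
              else do { x \<leftarrow> coef_op (- coef G a c); ret (set_coef a c x H) })
       [0..<dim_row G] G"

definition infl_pair_prog :: "nat \<Rightarrow> nat \<Rightarrow> int mat \<Rightarrow> int mat prog" where
  "infl_pair_prog a b G =
     do {
       H \<leftarrow> foldM
         (\<lambda>c H. if c = a \<or> c = b then ret H
                else do {
                  x \<leftarrow> coef_op (coef G a c * coef G a b);
                  y \<leftarrow> coef_op (coef G b c - x);
                  ret (set_coef b c y H)
                })
         [0..<dim_row G] G;
       z \<leftarrow> coef_op (- coef G a b);
       ret (set_coef a b z H)
     }"

text \<open>
  The argument \<open>es\<close> is the nonempty list of all dotted edges in lexicographic order.
\<close>

definition strategy :: "nat \<Rightarrow> (nat \<times> nat) list \<Rightarrow> (nat \<times> nat) set" where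
  "strategy s es =
     (if s = 0 then {hd es}
      else if s = 1 then {last es}
      else if s = 2 then {hd es, last es}
      else set es)"

text \<open>InflationsAtPair, stopped after \<open>k\<close> inflations.\<close>

primrec inflations_at_pair :: "nat \<Rightarrow> nat \<Rightarrow> int mat \<Rightarrow> int mat prog" where
  "inflations_at_pair s 0 G = ret G"
| "inflations_at_pair s (Suc k) G =
     do {
       es \<leftarrow> filterM (\<lambda>(a, b). coef_op (coef G a b > 0)) (vertex_pairs (dim_row G));
       if es = [] then ret G
       else do {
         (a, b) \<leftarrow> pick (strategy s es);
         H \<leftarrow> infl_pair_prog a b G;
         inflations_at_pair s k H
       }
     }"

definition \<mu> :: "nat \<Rightarrow> nat" where
  "\<mu> n =
     (if n \<in> {1, 2, 3} then (n\<^sup>2 - n) div 2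
      else if n = 6 then 30
      else if n = 7 then 56
      else if n = 8 then 112
      else n\<^sup>2 - 2 * n)"

definition \<mu>' :: "nat \<Rightarrow> nat" where
  "\<mu>' n =
     (if n \<in> {1, 2, 3} then 0
      else if n = 6 then 5
      else if n = 7 then 10
      else if n = 8 then 21
      else n - 3)"

definition inflations_at_pair_pos :: "int mat \<Rightarrow> nat \<Rightarrow> int mat prog" where
  "inflations_at_pair_pos G s = inflations_at_pair s (\<mu> (dim_row G)) G"

definition inflations_at_pair_poss :: "int mat \<Rightarrow> nat \<Rightarrow> int mat prog" where
  "inflations_at_pair_poss G s = inflations_at_pair s (\<mu>' (dim_row G)) G"

definition cut_pairs :: "nat \<Rightarrow> nat set \<Rightarrow> (nat \<times> nat) list" where
  "cut_pairs n S = filter (\<lambda>(a, b). a \<in> S \<and> b \<notin> S) (List.product [0..<n] [0..<n])"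

function root_loop :: "nat \<Rightarrow> nat set \<Rightarrow> int mat \<Rightarrow> int mat prog" where
  "root_loop n S G =
     (if card S < n then
        do {
          (a, b) \<leftarrow> do {
            es \<leftarrow> filterM (\<lambda>(a, b). coef_op (coef G a b \<noteq> 0)) (cut_pairs n S);
            pick (set es)
          };
          neg \<leftarrow> coef_op (coef G a b < 0);
          G' \<leftarrow> (if neg then infl_vertex_prog b G else ret G);
          G'' \<leftarrow> infl_pair_prog b a G';
          root_loop n (insert b S) G''
        }
      else ret G)"
  by pat_completeness auto

lemma filterM_op_pair:
  "filterM (\<lambda>(a, b). coef_op (P a b)) xs = Prog {(filter (\<lambda>(a, b). P a b) xs, length xs)}"
  using filterM_op[of "\<lambda>(a, b). P a b" xs] by (simp add: case_prod_unfold)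

termination
proof (relation "measure (\<lambda>(n, S, G). card ({..<n} - S))", goal_cases)
  case 1
  then show ?case by simp
next
  case (2 n S G x s a b)
  then have "b < n" "b \<notin> S"
    by (auto simp: filterM_op_pair pick_def cut_pairs_def)
  then have "{..<n} - insert b S \<subset> {..<n} - S" by auto
  then show ?case by (auto intro: psubset_card_mono)
qed

declare root_loop.simps [simp del]

definition inflations_to_pos_sincere_root :: "int mat \<Rightarrow> int mat prog" where
  "inflations_to_pos_sincere_root G = root_loop (dim_row G) {0} G"

text \<open>
  After all coefficients have been compared with \<open>0\<close> and \<open>-1\<close>, what remains is to
  recognise a simple graph, which involves no further operation on coefficients.
\<close>

definition is_dynkin_graph_prog :: "int mat \<Rightarrow> bool prog" where
  "is_dynkin_graph_prog G =
     do {
       zs \<leftarrow> filterM (\<lambda>(i, j). coef_op (coef G i j = 0)) (vertex_pairs (dim_row G));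
       es \<leftarrow> filterM (\<lambda>(i, j). coef_op (coef G i j = -1)) (vertex_pairs (dim_row G));
       ret (set (vertex_pairs (dim_row G)) \<subseteq> set zs \<union> set es \<and>
            is_dynkin_diagram (dim_row G) ((\<lambda>(i, j). {i, j}) ` set es))
     }"

definition pos_def_test_by_inflations :: "real mat \<Rightarrow> nat \<Rightarrow> bool prog" where
  "pos_def_test_by_inflations A s =
     do {
       G \<leftarrow> bigraph_of_prog A;
       D \<leftarrow> inflations_at_pair_pos G s;
       is_dynkin_graph_prog D
     }"

definition pos_def_test_by_root_inflations :: "real mat \<Rightarrow> nat \<Rightarrow> bool prog" where
  "pos_def_test_by_root_inflations A s =
     do {
       G \<leftarrow> bigraph_of_prog A;
       H \<leftarrow> inflations_to_pos_sincere_root G;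
       D \<leftarrow> inflations_at_pair_poss H s;
       is_dynkin_graph_prog D
     }"

definition pessimistic_complexity :: "(real mat \<Rightarrow> 'a prog) \<Rightarrow> nat \<Rightarrow> enat" where
  "pessimistic_complexity alg n =
     (SUP A \<in> {A \<in> carrier_mat n n. connected_matrix A \<and> unidiagonal A \<and> triangle_integral A}.
        SUP (r, t) \<in> runs (alg A). enat t)"


section \<open>The programs compute the functions they are meant to compute\<close>

lemma set_vertex_pairs: "set (vertex_pairs n) = {(i, j). i < j \<and> j < n}"
  by (auto simp: vertex_pairs_def image_iff)

lemma fold_set_coef:
  assumes G: "G \<in> carrier_mat n n" and H: "H \<in> carrier_mat n n"
    and H1: "\<And>x. x \<in> set xs \<Longrightarrow> coef H (u x) (v x) = f x"
    and H2: "\<And>i j. i < n \<Longrightarrow> j < n \<Longrightarrow>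
           (\<And>x. x \<in> set xs \<Longrightarrow> (i, j) \<noteq> (min (u x) (v x), max (u x) (v x))) \<Longrightarrow>
           H $$ (i, j) = G $$ (i, j)"
  shows "fold (\<lambda>x. set_coef (u x) (v x) (f x)) xs G = H"
proof -
  let ?F = "\<lambda>xs. fold (\<lambda>x. set_coef (u x) (v x) (f x)) xs G"
  let ?P = "\<lambda>xs i j. \<exists>x \<in> set xs. (i, j) = (min (u x) (v x), max (u x) (v x))"
  have *: "?F ys \<in> carrier_mat n n \<and>
      (\<forall>i<n. \<forall>j<n. ?F ys $$ (i, j) = (if ?P ys i j then H $$ (i, j) else G $$ (i, j)))"
    if "set ys \<subseteq> set xs" for ys
    using that
  proof (induction ys rule: rev_induct)
    case Nil
    then show ?case using G by simp
  next
    case (snoc y ys)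
    then have IH: "?F ys \<in> carrier_mat n n"
      "\<And>i j. i < n \<Longrightarrow> j < n \<Longrightarrow>
         ?F ys $$ (i, j) = (if ?P ys i j then H $$ (i, j) else G $$ (i, j))"
      by auto
    have e: "set_coef (u y) (v y) (f y) (?F ys) $$ (i, j) =
        (if (i, j) = (min (u y) (v y), max (u y) (v y)) then f y else ?F ys $$ (i, j))"
      if "i < n" "j < n" for i j
      using IH(1) that by (simp add: set_coef_def update_mat_def)
    have c: "set_coef (u y) (v y) (f y) (?F ys) \<in> carrier_mat n n"
      using IH(1) by (simp add: set_coef_def update_mat_def)
    have "f y = H $$ (min (u y) (v y), max (u y) (v y))"
      using H1[of y] snoc.prems by (simp add: coef_def)
    then show ?case using IH(2) c e by auto
  qed
  from *[of xs] have c: "?F xs \<in> carrier_mat n n"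
    and e: "\<And>i j. i < n \<Longrightarrow> j < n \<Longrightarrow>
      ?F xs $$ (i, j) = (if ?P xs i j then H $$ (i, j) else G $$ (i, j))"
    by auto
  show ?thesis
  proof (rule eq_matI)
    fix i j assume "i < dim_row H" "j < dim_col H"
    then have ij: "i < n" "j < n" using H by auto
    show "?F xs $$ (i, j) = H $$ (i, j)"
    proof (cases "?P xs i j")
      case True
      then show ?thesis by (simp add: e ij)
    next
      case False
      then have "H $$ (i, j) = G $$ (i, j)" by (intro H2 ij) blast
      then show ?thesis by (simp add: e ij)
    qed
  qed (use c H in auto)
qed

lemma bigraph_of_prog_correct:
  assumes "A \<in> carrier_mat n n"
  shows "bigraph_of_prog A = Prog {(bigraph_of A, length (vertex_pairs n))}"
proof -
  let ?f = "\<lambda>p. \<lfloor>A $$ (fst p, snd p) + A $$ (snd p, fst p)\<rfloor>"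
  let ?F = "fold (\<lambda>p. set_coef (fst p) (snd p) (?f p)) (vertex_pairs n) (1\<^sub>m n)"
  have "bigraph_of_prog A = Prog {(?F, sum_list (map (\<lambda>_. 1) (vertex_pairs n)))}"
    using assms unfolding bigraph_of_prog_def
    by (subst foldM_det[where g = "\<lambda>p. set_coef (fst p) (snd p) (?f p)" and t = "\<lambda>_. 1"])
      (auto simp: coef_op_def ret_def)
  moreover have "?F = bigraph_of A"
  proof (rule fold_set_coef[where n = n])
    fix i j
    assume ij: "i < n" "j < n" and
      nc: "\<And>x. x \<in> set (vertex_pairs n) \<Longrightarrow> (i, j) \<noteq> (min (fst x) (snd x), max (fst x) (snd x))"
    have "\<not> i < j" using nc[of "(i, j)"] ij by (auto simp: set_vertex_pairs)
    then show "bigraph_of A $$ (i, j) = 1\<^sub>m n $$ (i, j)"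
      using ij assms by (simp add: bigraph_of_def)
  qed (use assms in \<open>auto simp: set_vertex_pairs bigraph_of_def nabla_def coef_def\<close>)
  ultimately show ?thesis by (simp add: sum_list_triv)
qed

lemma infl_vertex_prog_correct:
  assumes G: "G \<in> carrier_mat n n" and a: "a < n"
  shows "infl_vertex_prog a G = Prog {(infl_vertex a G, n - 1)}"
proof -
  let ?xs = "filter (\<lambda>c. c \<noteq> a) [0..<n]"
  let ?F = "fold (\<lambda>c. set_coef a c (- coef G a c)) ?xs G"
  have "infl_vertex_prog a G = Prog {(?F, sum_list (map (\<lambda>c. if c \<noteq> a then 1 else 0) [0..<n]))}"
    using G unfolding infl_vertex_prog_def fold_filter
    by (subst foldM_det
        [where g = "\<lambda>c. if c \<noteq> a then set_coef a c (- coef G a c) else id"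
          and t = "\<lambda>c. if c \<noteq> a then 1 else 0"])
      (auto simp: coef_op_def ret_def)
  moreover have "?F = infl_vertex a G"
  proof (rule fold_set_coef[where n = n])
    fix i j
    assume ij: "i < n" "j < n" and
      nc: "\<And>x. x \<in> set ?xs \<Longrightarrow> (i, j) \<noteq> (min a x, max a x)"
    have "\<not> (i < j \<and> (i = a \<or> j = a))" using nc[of i] nc[of j] ij by auto
    then show "infl_vertex a G $$ (i, j) = G $$ (i, j)"
      using ij G by (auto simp: infl_vertex_def)
  qed (use assms in \<open>auto simp: infl_vertex_def coef_def min_def max_def\<close>)
  moreover have "sum_list (map (\<lambda>c. if c \<noteq> a then 1 else 0) [0..<n]) = n - (1::nat)"
  proof -
    have "sum_list (map (\<lambda>c. if c \<noteq> a then 1 else 0) [0..<n]) = (\<Sum>c\<in>{..<n}. if c \<noteq> a then 1 else (0::nat))"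
      by (simp add: sum_list_distinct_conv_sum_set lessThan_atLeast0)
    also have "\<dots> = card ({..<n} - {a})"
      by (simp add: sum.If_cases Collect_neg_eq[symmetric] set_diff_eq Int_def)
    finally show ?thesis using a by simp
  qed
  ultimately show ?thesis by simp
qed

lemma infl_pair_prog_correct:
  assumes G: "G \<in> carrier_mat n n" and ab: "a < n" "b < n" "a \<noteq> b"
  shows "infl_pair_prog a b G = Prog {(infl_pair a b G, 2 * (n - 2) + 1)}"
proof -
  let ?xs = "filter (\<lambda>c. c \<noteq> a \<and> c \<noteq> b) [0..<n]"
  let ?f = "\<lambda>c. coef G b c - coef G a c * coef G a b"
  let ?F = "fold (\<lambda>c. set_coef b c (?f c)) ?xs G"
  let ?t = "\<lambda>c. if c \<noteq> a \<and> c \<noteq> b then 2 else (0::nat)"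
  have "infl_pair_prog a b G =
      Prog {(set_coef a b (- coef G a b) ?F, sum_list (map ?t [0..<n]) + 1)}"
    using G unfolding infl_pair_prog_def fold_filter
    by (subst foldM_det
        [where g = "\<lambda>c. if c \<noteq> a \<and> c \<noteq> b then set_coef b c (?f c) else id" and t = ?t])
      (auto simp: coef_op_def ret_def)
  moreover have "set_coef a b (- coef G a b) ?F = infl_pair a b G"
  proof -
    let ?g = "\<lambda>c. if c = a then - coef G a b else ?f c"
    have "?F = fold (\<lambda>c. set_coef b c (?g c)) ?xs G"
      by (intro fold_cong) auto
    then have "set_coef a b (- coef G a b) ?F = fold (\<lambda>c. set_coef b c (?g c)) (?xs @ [a]) G"
      by (simp add: set_coef_def min.commute max.commute)
    also have "\<dots> = infl_pair a b G"
    proof (rule fold_set_coef[where n = n])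
      fix x assume "x \<in> set (?xs @ [a])"
      then have "x < n" "x \<noteq> b" using ab by auto
      then show "coef (infl_pair a b G) b x = (if x = a then - coef G a b else ?f x)"
        using G ab by (cases "b < x") (auto simp: infl_pair_def coef_def doubleton_eq_iff min_def max_def)
    next
      fix i j
      assume ij: "i < n" "j < n" and
        nc: "\<And>x. x \<in> set (?xs @ [a]) \<Longrightarrow> (i, j) \<noteq> (min b x, max b x)"
      have "\<not> (i < j \<and> (i = b \<or> j = b))" using nc[of i] nc[of j] ij by (auto split: if_splits)
      then show "infl_pair a b G $$ (i, j) = G $$ (i, j)"
        using ij G by (auto simp: infl_pair_def doubleton_eq_iff)
    qed (use G in \<open>auto simp: infl_pair_def\<close>)
    finally show ?thesis .
  qed
  moreover have "sum_list (map ?t [0..<n]) = 2 * (n - 2)"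
  proof -
    have "sum_list (map ?t [0..<n]) = (\<Sum>c\<in>{..<n}. ?t c)"
      by (simp add: sum_list_distinct_conv_sum_set lessThan_atLeast0)
    also have "\<dots> = (\<Sum>c\<in>{..<n} - {a, b}. 2)"
      by (rule sum.mono_neutral_cong_right) auto
    also have "\<dots> = 2 * card ({..<n} - {a, b})" by simp
    also have "card ({..<n} - {a, b}) = n - 2"
      using ab by (subst card_Diff_subset) auto
    finally show ?thesis .
  qed
  ultimately show ?thesis by simp
qed

lemma is_dynkin_graph_prog_correct:
  "is_dynkin_graph_prog G = Prog {(is_dynkin_graph G, 2 * length (vertex_pairs (dim_row G)))}"
proof -
  have "(\<lambda>(i, j). {i, j}) ` set (filter (\<lambda>(i, j). coef G i j = -1) (vertex_pairs (dim_row G))) =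
      {{i, j} | i j. i < j \<and> j < dim_row G \<and> coef G i j = -1}"
    by (auto simp: set_vertex_pairs)
  moreover have "set (vertex_pairs (dim_row G)) \<subseteq>
      set (filter (\<lambda>(i, j). coef G i j = 0) (vertex_pairs (dim_row G))) \<union>
      set (filter (\<lambda>(i, j). coef G i j = -1) (vertex_pairs (dim_row G))) \<longleftrightarrow>
      (\<forall>i j. i < j \<and> j < dim_row G \<longrightarrow> coef G i j \<in> {0, -1})"
    by (auto simp: set_vertex_pairs)
  ultimately show ?thesis
    unfolding is_dynkin_graph_prog_def filterM_op_pair is_dynkin_graph_def
    by (simp add: ret_def del: set_filter)
qed


section \<open>Every admissible input has a run\<close>

text \<open>
  Hence the suprema in \<^const>\<open>pessimistic_complexity\<close> range over nonempty sets: the choice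
  in the computation of a sincere root is always possible if the bigraph is connected.
\<close>

lemma bind_prog_nonempty:
  "runs m \<noteq> {} \<Longrightarrow> (\<And>x s. (x, s) \<in> runs m \<Longrightarrow> runs (f x) \<noteq> {}) \<Longrightarrow> runs (bind_prog m f) \<noteq> {}"
  unfolding bind_prog_def by fastforce

lemma sym_adjacency: "sym (adjacency G)"
  by (auto simp: sym_def adjacency_def coef_def min.commute max.commute)

lemma infl_carrier [simp]:
  assumes "G \<in> carrier_mat n n"
  shows "infl_vertex a G \<in> carrier_mat n n" "infl_pair a b G \<in> carrier_mat n n"
  using assms by (auto simp: infl_vertex_def infl_pair_def)

lemma coef_infl_vertex:
  assumes "G \<in> carrier_mat n n" "i < n" "j < n" "i \<noteq> j"
  shows "coef (infl_vertex a G) i j = (if i = a \<or> j = a then - coef G i j else coef G i j)"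
  using assms by (auto simp: infl_vertex_def coef_def min_def max_def)

lemma coef_infl_pair:
  assumes "G \<in> carrier_mat n n" "i < n" "j < n" "i \<noteq> j"
  shows "coef (infl_pair a b G) i j =
    (if {i, j} = {a, b} then - coef G a b
     else if i = b then coef G b j - coef G a j * coef G a b
     else if j = b then coef G b i - coef G a i * coef G a b
     else coef G i j)"
  using assms by (cases "i < j") (auto simp: infl_pair_def coef_def min_def max_def doubleton_eq_iff)

lemma connected_infl_vertex:
  assumes "G \<in> carrier_mat n n" "connected_bigraph G"
  shows "connected_bigraph (infl_vertex a G)"
proof -
  have "adjacency (infl_vertex a G) = adjacency G"
    using assms(1) carrier_matD(1)[OF infl_carrier(1)[OF assms(1), of a]]
    by (auto simp: adjacency_def coef_infl_vertex[OF assms(1)] split: if_splits)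
  then show ?thesis
    using assms carrier_matD(1)[OF infl_carrier(1)[OF assms(1), of a]]
    by (auto simp: connected_bigraph_def)
qed

lemma connected_infl_pair:
  assumes G: "G \<in> carrier_mat n n" and conn: "connected_bigraph G"
    and ab: "a < n" "b < n" "a \<noteq> b" "coef G a b \<noteq> 0"
  shows "connected_bigraph (infl_pair a b G)"
proof -
  let ?H = "infl_pair a b G"
  have H: "?H \<in> carrier_mat n n" using G by simp
  have dH: "dim_row ?H = n" using H by auto
  have dG: "dim_row G = n" using G by auto
  have adj: "(a, b) \<in> (adjacency ?H)\<^sup>*"
    using ab dH by (intro r_into_rtrancl) (simp add: adjacency_def coef_infl_pair[OF G])
  have symH: "(v, u) \<in> (adjacency ?H)\<^sup>*" if "(u, v) \<in> (adjacency ?H)\<^sup>*" for u v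
    using that sym_rtrancl[OF sym_adjacency] by (meson symD)
  have b: "(b, c) \<in> (adjacency ?H)\<^sup>*" if c: "c < n" "c \<noteq> b" "coef G b c \<noteq> 0" for c
  proof (cases "c = a")
    case True
    then show ?thesis using adj symH by blast
  next
    case ca: False
    have e: "coef ?H b c = coef G b c - coef G a c * coef G a b"
      using c ca ab by (simp add: coef_infl_pair[OF G] doubleton_eq_iff)
    show ?thesis
    proof (cases "coef ?H b c = 0")
      case False
      then show ?thesis using c ab dH by (intro r_into_rtrancl) (simp add: adjacency_def)
    next
      case True
      then have "coef G a c \<noteq> 0" using e c by auto
      then have "coef ?H a c \<noteq> 0"
        using c ca ab by (simp add: coef_infl_pair[OF G] doubleton_eq_iff)
      then have "(a, c) \<in> (adjacency ?H)\<^sup>*"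
        using c ca ab dH by (intro r_into_rtrancl) (simp add: adjacency_def)
      then show ?thesis using adj symH rtrancl_trans by metis
    qed
  qed
  have "adjacency G \<subseteq> (adjacency ?H)\<^sup>*"
  proof (clarify)
    fix u v assume "(u, v) \<in> adjacency G"
    then have uv: "u < n" "v < n" "u \<noteq> v" "coef G u v \<noteq> 0" using dG by (auto simp: adjacency_def)
    have sc: "coef G v u = coef G u v" by (simp add: coef_def min.commute max.commute)
    consider "u = b" | "v = b" | "u \<noteq> b" "v \<noteq> b" by blast
    then show "(u, v) \<in> (adjacency ?H)\<^sup>*"
    proof cases
      case 1
      then show ?thesis using b uv by auto
    next
      case 2
      then show ?thesis using b[of u] uv sc symH by auto
    next
      case 3
      then have "coef ?H u v \<noteq> 0"
        using uv by (auto simp: coef_infl_pair[OF G] doubleton_eq_iff)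
      then show ?thesis using uv dH by (intro r_into_rtrancl) (simp add: adjacency_def)
    qed
  qed
  then have "(adjacency G)\<^sup>* \<subseteq> (adjacency ?H)\<^sup>*"
    using rtrancl_subset_rtrancl by blast
  then show ?thesis using conn dG dH by (auto simp: connected_bigraph_def)
qed

lemma cut_edge:
  assumes "G \<in> carrier_mat n n" "connected_bigraph G" "0 \<in> S" "S \<subseteq> {..<n}" "card S < n"
  obtains a b where "(a, b) \<in> set (cut_pairs n S)" "coef G a b \<noteq> 0"
proof -
  have "S \<noteq> {..<n}" using assms(5) by auto
  then obtain v where v: "v < n" "v \<notin> S" using assms(4) by auto
  have d: "dim_row G = n" using assms(1) by auto
  have "(0, v) \<in> (adjacency G)\<^sup>*" using assms(2) v d by (auto simp: connected_bigraph_def)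
  then have "v \<notin> S \<longrightarrow> (\<exists>(a, b) \<in> adjacency G. a \<in> S \<and> b \<notin> S)"
    by (induction rule: rtrancl_induct) (use assms(3) in auto)
  then obtain a b where "(a, b) \<in> adjacency G" "a \<in> S" "b \<notin> S" using v by auto
  then show thesis using d that[of a b] by (auto simp: adjacency_def cut_pairs_def)
qed

lemma root_loop_nonempty:
  assumes "G \<in> carrier_mat n n" "connected_bigraph G" "0 \<in> S" "S \<subseteq> {..<n}"
  shows "runs (root_loop n S G) \<noteq> {} \<and> (\<forall>(H, t) \<in> runs (root_loop n S G). H \<in> carrier_mat n n)"
  using assms
proof (induction "card ({..<n} - S)" arbitrary: S G rule: less_induct)
  case less
  show ?case
  proof (cases "card S < n")
    case False
    then show ?thesis using less.prems by (simp add: root_loop.simps ret_def)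
  next
    case True
    define Q where "Q = bind_prog (filterM (\<lambda>(a, b). coef_op (coef G a b \<noteq> 0)) (cut_pairs n S)) (\<lambda>es. pick (set es))"
    define R where "R = (\<lambda>a b. do {
          neg \<leftarrow> coef_op (coef G a b < 0);
          G' \<leftarrow> (if neg then infl_vertex_prog b G else ret G);
          G'' \<leftarrow> infl_pair_prog b a G';
          root_loop n (insert b S) G'' })"
    have eq: "root_loop n S G = bind_prog Q (\<lambda>(a, b). R a b)"
      using True by (simp add: root_loop.simps[of n S G] Q_def R_def)
    have Q': "(a, b) \<in> set (cut_pairs n S) \<and> coef G a b \<noteq> 0" if "((a, b), s) \<in> runs Q" for a b s
      using that by (auto simp: Q_def filterM_op_pair pick_def)
    have ne: "runs Q \<noteq> {}"
      using cut_edge[OF less.prems True] by (fastforce simp: Q_def filterM_op_pair pick_def)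
    have R: "runs (R a b) \<noteq> {} \<and> (\<forall>(H, t) \<in> runs (R a b). H \<in> carrier_mat n n)"
      if "(a, b) \<in> set (cut_pairs n S) \<and> coef G a b \<noteq> 0" for a b
    proof -
      have ab: "a < n" "b < n" "a \<in> S" "b \<notin> S" "b \<noteq> a" "coef G a b \<noteq> 0"
        using that by (auto simp: cut_pairs_def)
      define G' where "G' = (if coef G a b < 0 then infl_vertex b G else G)"
      have G': "G' \<in> carrier_mat n n" "connected_bigraph G'" "coef G' b a \<noteq> 0"
        using less.prems(1,2) ab connected_infl_vertex
        by (auto simp: G'_def coef_infl_vertex) (auto simp: coef_def min.commute max.commute)
      define G'' where "G'' = infl_pair b a G'"
      have G'': "G'' \<in> carrier_mat n n" "connected_bigraph G''"
        using G' ab by (auto simp: G''_def intro!: connected_infl_pair)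
      have "{..<n} - insert b S \<subset> {..<n} - S" using ab by auto
      then have "card ({..<n} - insert b S) < card ({..<n} - S)"
        by (auto intro: psubset_card_mono)
      from less.hyps[OF this G''] less.prems ab
      have IH: "runs (root_loop n (insert b S) G'') \<noteq> {} \<and>
          (\<forall>(H, t) \<in> runs (root_loop n (insert b S) G''). H \<in> carrier_mat n n)"
        by auto
      obtain k where k: "(if coef G a b < 0 then infl_vertex_prog b G else ret G) = Prog {(G', k)}"
        using infl_vertex_prog_correct[OF less.prems(1) ab(2)]
        by (cases "coef G a b < 0") (auto simp: G'_def ret_def)
      have "R a b = bind_prog (coef_op (coef G a b < 0)) (\<lambda>neg. bind_prog
          (if neg then infl_vertex_prog b G else ret G)
          (\<lambda>G'. bind_prog (infl_pair_prog b a G') (root_loop n (insert b S))))"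
        by (simp add: R_def)
      also have "\<dots> = Prog ((\<lambda>(y, t). (y, 1 + t)) ` runs (bind_prog (Prog {(G', k)})
          (\<lambda>G'. bind_prog (infl_pair_prog b a G') (root_loop n (insert b S)))))"
        using k by (simp add: coef_op_def)
      finally show ?thesis
        using IH infl_pair_prog_correct[OF G'(1) ab(2,1,5)] by (auto simp: G''_def[symmetric])
    qed
    have "runs (root_loop n S G) \<noteq> {}"
      unfolding eq using ne R Q' by (intro bind_prog_nonempty) auto
    moreover have "\<forall>(H, t) \<in> runs (root_loop n S G). H \<in> carrier_mat n n"
      unfolding eq using R Q' by (fastforce simp: bind_prog_def)
    ultimately show ?thesis by blast
  qed
qed

lemma inflations_at_pair_nonempty:
  "G \<in> carrier_mat n n \<Longrightarrow> runs (inflations_at_pair s k G) \<noteq> {}"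
proof (induction k arbitrary: G)
  case 0
  then show ?case by (simp add: ret_def)
next
  case (Suc k)
  let ?es = "filter (\<lambda>(a, b). coef G a b > 0) (vertex_pairs n)"
  have d: "dim_row G = n" using Suc.prems by auto
  show ?case
  proof (cases "?es = []")
    case True
    then show ?thesis by (simp add: d filterM_op_pair ret_def)
  next
    case False
    have st: "strategy s es \<noteq> {} \<and> strategy s es \<subseteq> set es" if "es \<noteq> []" for es
      using that by (auto simp: strategy_def)
    note st = st[OF False, THEN conjunct1] st[OF False, THEN conjunct2]
    have "runs (bind_prog (pick (strategy s ?es))
        (\<lambda>(a, b). bind_prog (infl_pair_prog a b G) (inflations_at_pair s k))) \<noteq> {}"
    proof (rule bind_prog_nonempty)
      show "runs (pick (strategy s ?es)) \<noteq> {}" using st by (simp add: pick_def)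
    next
      fix p t assume p: "(p, t) \<in> runs (pick (strategy s ?es))"
      obtain a b where ab: "p = (a, b)" by (cases p)
      have "a < n" "b < n" "a \<noteq> b"
        using p ab st(2) by (auto simp: pick_def set_vertex_pairs)
      then show "runs (case p of (a, b) \<Rightarrow>
          bind_prog (infl_pair_prog a b G) (inflations_at_pair s k)) \<noteq> {}"
        using Suc by (simp add: ab infl_pair_prog_correct)
    qed
    then show ?thesis using False by (simp add: d filterM_op_pair)
  qed
qed

lemma runs_nonempty:
  assumes "A \<in> carrier_mat n n" "n \<ge> 1" "connected_matrix A"
  shows "runs (pos_def_test_by_inflations A s) \<noteq> {}"
    and "runs (pos_def_test_by_root_inflations A s) \<noteq> {}"
proof -
  have G: "bigraph_of A \<in> carrier_mat n n" using assms(1) by (auto simp: bigraph_of_def)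
  show "runs (pos_def_test_by_inflations A s) \<noteq> {}"
    unfolding pos_def_test_by_inflations_def bigraph_of_prog_correct[OF assms(1)]
      inflations_at_pair_pos_def
    using bind_prog_nonempty[OF inflations_at_pair_nonempty[OF G], where f = is_dynkin_graph_prog]
    by (simp add: is_dynkin_graph_prog_correct)
  have d: "dim_row (bigraph_of A) = n" using G by auto
  have *: "runs (root_loop n {0} (bigraph_of A)) \<noteq> {} \<and>
      (\<forall>(H, t) \<in> runs (root_loop n {0} (bigraph_of A)). H \<in> carrier_mat n n)"
    using assms G by (intro root_loop_nonempty) (auto simp: connected_matrix_def)
  have "runs (bind_prog (root_loop n {0} (bigraph_of A)) (\<lambda>H.
      bind_prog (inflations_at_pair s (\<mu>' (dim_row H)) H) is_dynkin_graph_prog)) \<noteq> {}"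
  proof (intro bind_prog_nonempty)
    fix H t assume "(H, t) \<in> runs (root_loop n {0} (bigraph_of A))"
    then have "H \<in> carrier_mat n n" using * by auto
    then show "runs (inflations_at_pair s (\<mu>' (dim_row H)) H) \<noteq> {}"
      by (rule inflations_at_pair_nonempty)
  qed (use * in \<open>auto simp: is_dynkin_graph_prog_correct\<close>)
  then show "runs (pos_def_test_by_root_inflations A s) \<noteq> {}"
    unfolding pos_def_test_by_root_inflations_def bigraph_of_prog_correct[OF assms(1)]
      inflations_at_pair_poss_def inflations_to_pos_sincere_root_def
    by (simp add: d)
qed

end

theory Submission
  imports Defs
begin

text \<open>
  One pass through the loop of the inflation algorithm scans all \<open>O(n\<^sup>2)\<close> coefficients and then
  performs an inflation, which costs only \<open>O(n)\<close> operations.  As the number of passes is at most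
  \<open>\<mu> n = O(n\<^sup>2)\<close> or \<open>\<mu>' n = O(n)\<close>, the loop costs \<open>O(n\<^sup>4)\<close> or \<open>O(n\<^sup>3)\<close>.  The computation of a sincere
  root makes at most \<open>n\<close> passes of cost \<open>O(n\<^sup>2)\<close>, since each of them adds a vertex to \<open>S\<close>.
\<close>

text \<open>Result and cost are bounded together because the cost of a later stage depends on the
  dimension of the matrix delivered by an earlier one. The predicate holds vacuously for a program
  without runs, which does no harm when bounding a supremum from above.\<close>

definition all_runs :: "'a prog \<Rightarrow> ('a \<Rightarrow> bool) \<Rightarrow> nat \<Rightarrow> bool" where
  "all_runs m P k \<longleftrightarrow> (\<forall>(x, t) \<in> runs m. P x \<and> t \<le> k)"

lemma all_runs_ret: "P x \<Longrightarrow> all_runs (ret x) P k"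
  by (simp add: all_runs_def ret_def)

lemma all_runs_Prog: "P x \<Longrightarrow> t \<le> k \<Longrightarrow> all_runs (Prog {(x, t)}) P k"
  by (simp add: all_runs_def)

lemma all_runs_coef_op: "all_runs (coef_op x) (\<lambda>y. y = x) 1"
  by (simp add: all_runs_def coef_op_def)

lemma all_runs_pick: "all_runs (pick X) (\<lambda>x. x \<in> X) 0"
  by (auto simp: all_runs_def pick_def)

lemma all_runs_mono:
  "all_runs m P k \<Longrightarrow> (\<And>x. P x \<Longrightarrow> Q x) \<Longrightarrow> k \<le> l \<Longrightarrow> all_runs m Q l"
  unfolding all_runs_def by fastforce

text \<open>Costs add along a sequential composition. The bound \<open>l\<close> is uniform in the
  intermediate result, of which only \<open>P\<close> is remembered.\<close>

lemma all_runs_bind: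
  assumes "all_runs m P k" "\<And>x. P x \<Longrightarrow> all_runs (f x) Q l"
  shows "all_runs (bind_prog m f) Q (k + l)"
  using assms unfolding all_runs_def bind_prog_def by (fastforce intro: add_mono)

lemma all_runs_filterM_op_pair:
  "all_runs (filterM (\<lambda>(a, b). coef_op (P a b)) xs)
     (\<lambda>ys. ys = filter (\<lambda>(a, b). P a b) xs) (length xs)"
  by (simp add: all_runs_def filterM_op_pair)

lemma length_vertex_pairs_le: "length (vertex_pairs n) \<le> n\<^sup>2"
proof -
  have "length (vertex_pairs n) = (\<Sum>i\<leftarrow>[0..<n]. n - Suc i)"
    by (simp add: vertex_pairs_def length_concat comp_def)
  also have "\<dots> \<le> (\<Sum>i\<leftarrow>[0..<n]. n)" by (rule sum_list_mono) simp
  also have "\<dots> = n * n" by (simp add: sum_list_triv)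
  finally show ?thesis by (simp add: power2_eq_square)
qed

lemma length_cut_pairs_le: "length (cut_pairs n S) \<le> n\<^sup>2"
  unfolding cut_pairs_def
  by (rule order_trans[OF length_filter_le]) (simp add: power2_eq_square)

lemma strategy_subset: "es \<noteq> [] \<Longrightarrow> strategy s es \<subseteq> set es"
  by (auto simp: strategy_def)

lemma all_runs_infl_pair_prog:
  assumes "G \<in> carrier_mat n n" "a < n" "b < n" "a \<noteq> b"
  shows "all_runs (infl_pair_prog a b G) (\<lambda>H. H \<in> carrier_mat n n) (2 * n)"
  unfolding infl_pair_prog_correct[OF assms] using assms by (intro all_runs_Prog) auto

lemma all_runs_inflations_at_pair:
  "G \<in> carrier_mat n n \<Longrightarrow>
   all_runs (inflations_at_pair s k G) (\<lambda>H. H \<in> carrier_mat n n) (k * (n\<^sup>2 + 2 * n))"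
proof (induction k arbitrary: G)
  case 0
  then show ?case by (simp add: all_runs_ret)
next
  case (Suc k)
  let ?C = "\<lambda>H. H \<in> carrier_mat n n"
  let ?es = "filter (\<lambda>(a, b). coef G a b > 0) (vertex_pairs n)"
  have d: "dim_row G = n" using Suc.prems by auto
  \<comment> \<open>For a nonempty list every strategy selects a listed edge, that is, a pair
    \<open>a < b < n\<close>; this meets the side conditions for the cost of an inflation.\<close>
  have step: "all_runs (bind_prog (pick (strategy s ?es))
        (\<lambda>(a, b). bind_prog (infl_pair_prog a b G) (inflations_at_pair s k)))
      ?C (0 + (2 * n + k * (n\<^sup>2 + 2 * n)))" if "?es \<noteq> []"
  proof (rule all_runs_bind[OF all_runs_pick])
    fix p assume p: "p \<in> strategy s ?es"
    obtain a b where ab: "p = (a, b)" by (cases p)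
    have "a < n" "b < n" "a \<noteq> b"
      using subsetD[OF strategy_subset[OF that] p] by (auto simp: ab set_vertex_pairs)
    then show "all_runs (case p of (a, b) \<Rightarrow>
        bind_prog (infl_pair_prog a b G) (inflations_at_pair s k)) ?C (2 * n + k * (n\<^sup>2 + 2 * n))"
      using all_runs_bind[OF all_runs_infl_pair_prog Suc.IH] Suc.prems ab by simp
  qed
  have "all_runs (inflations_at_pair s (Suc k) G) ?C
      (length (vertex_pairs n) + (2 * n + k * (n\<^sup>2 + 2 * n)))"
    unfolding inflations_at_pair.simps d
    by (rule all_runs_bind[OF all_runs_filterM_op_pair])
      (use step Suc.prems in \<open>auto intro: all_runs_ret\<close>)
  then show ?case
    by (rule all_runs_mono) (use length_vertex_pairs_le[of n] in auto)
qed

text \<open>Induction on the number of vertices outside \<open>S\<close>, which drops by exactly one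
  per pass. A pass costs at most \<open>n\<^sup>2\<close> for the scan, 1 for the sign test,
  \<open>n - 1\<close> for the vertex inflation and \<open>2 * n\<close> for the pair
  inflation.\<close>

lemma all_runs_root_loop:
  "G \<in> carrier_mat n n \<Longrightarrow>
   all_runs (root_loop n S G) (\<lambda>H. H \<in> carrier_mat n n) (card ({..<n} - S) * (n\<^sup>2 + 3 * n))"
proof (induction "card ({..<n} - S)" arbitrary: S G rule: less_induct)
  case less
  let ?C = "\<lambda>H. H \<in> carrier_mat n n"
  show ?case
  proof (cases "card S < n")
    case False
    then show ?thesis using less.prems by (simp add: root_loop.simps all_runs_ret)
  next
    case True
    define Q where "Q = bind_prog
      (filterM (\<lambda>(a, b). coef_op (coef G a b \<noteq> 0)) (cut_pairs n S)) (\<lambda>es. pick (set es))"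
    define R where "R = (\<lambda>a b. do {
          neg \<leftarrow> coef_op (coef G a b < 0);
          G' \<leftarrow> (if neg then infl_vertex_prog b G else ret G);
          G'' \<leftarrow> infl_pair_prog b a G';
          root_loop n (insert b S) G'' })"
    have eq: "root_loop n S G = bind_prog Q (\<lambda>(a, b). R a b)"
      using True by (simp add: root_loop.simps[of n S G] Q_def R_def)
    \<comment> \<open>Of the chosen pair only its membership in the cut is kept; that its
      coefficient is nonzero does not affect the cost.\<close>
    have Q: "all_runs Q (\<lambda>p. p \<in> set (cut_pairs n S)) (n\<^sup>2 + 0)"
      unfolding Q_def
    proof (rule all_runs_bind)
      show "all_runs (filterM (\<lambda>(a, b). coef_op (coef G a b \<noteq> 0)) (cut_pairs n S))
          (\<lambda>es. set es \<subseteq> set (cut_pairs n S)) (n\<^sup>2)"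
        by (rule all_runs_mono[OF all_runs_filterM_op_pair])
          (use length_cut_pairs_le in auto)
      show "all_runs (pick (set es)) (\<lambda>p. p \<in> set (cut_pairs n S)) 0"
        if "set es \<subseteq> set (cut_pairs n S)" for es :: "(nat \<times> nat) list"
        by (rule all_runs_mono[OF all_runs_pick]) (use that in auto)
    qed
    have R: "all_runs (R a b) ?C (3 * n + (card ({..<n} - S) - 1) * (n\<^sup>2 + 3 * n))"
        and pos: "0 < card ({..<n} - S)"
      if "(a, b) \<in> set (cut_pairs n S)" for a b
    proof -
      have ab: "a < n" "b < n" "b \<notin> S" "b \<noteq> a"
        using that by (auto simp: cut_pairs_def)
      \<comment> \<open>The vertex \<open>b\<close> lies outside \<open>S\<close>. Hence
        \<open>card ({..<n} - S) - 1\<close> is a genuine subtraction, and the induction hypothesis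
        applies to \<open>insert b S\<close>.\<close>
      show pos: "0 < card ({..<n} - S)"
        using ab by (auto simp: card_gt_0_iff)
      have "{..<n} - insert b S = ({..<n} - S) - {b}" by auto
      then have card: "card ({..<n} - insert b S) = card ({..<n} - S) - 1"
        using ab by simp
      have neg: "all_runs (if neg then infl_vertex_prog b G else ret G) ?C (n - 1)" for neg
        using less.prems ab
        by (auto simp: infl_vertex_prog_correct intro: all_runs_ret all_runs_Prog)
      have "all_runs (R a b) ?C
          (1 + ((n - 1) + (2 * n + (card ({..<n} - S) - 1) * (n\<^sup>2 + 3 * n))))"
        unfolding R_def
      proof (intro all_runs_bind[OF all_runs_coef_op] all_runs_bind[OF neg])
        fix G' :: "int mat" assume "G' \<in> carrier_mat n n"
        then show "all_runs (bind_prog (infl_pair_prog b a G') (root_loop n (insert b S)))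
            ?C (2 * n + (card ({..<n} - S) - 1) * (n\<^sup>2 + 3 * n))"
        proof (rule all_runs_bind[OF all_runs_infl_pair_prog[OF _ ab(2,1,4)]])
          fix G'' :: "int mat" assume "G'' \<in> carrier_mat n n"
          then show "all_runs (root_loop n (insert b S) G'') ?C
              ((card ({..<n} - S) - 1) * (n\<^sup>2 + 3 * n))"
            using less.hyps[of "insert b S" G''] card pos by simp
        qed
      qed
      \<comment> \<open>Since \<open>b < n\<close>, the sign test and the vertex inflation together
        cost \<open>1 + (n - 1) = n\<close>.\<close>
      then show "all_runs (R a b) ?C (3 * n + (card ({..<n} - S) - 1) * (n\<^sup>2 + 3 * n))"
        by (rule all_runs_mono) (use ab in auto)
    qed
    show ?thesis
    proof (cases "set (cut_pairs n S) = {}")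
      case True
      \<comment> \<open>With an empty cut nothing can be chosen, so there is no run and the bound is
        vacuous.\<close>
      then show ?thesis using Q by (auto simp: eq all_runs_def bind_prog_def)
    next
      case False
      then have "0 < card ({..<n} - S)" using pos by (metis ex_in_conv surj_pair)
      then obtain k where k: "card ({..<n} - S) = Suc k" using gr0_implies_Suc by blast
      have "all_runs (root_loop n S G) ?C
          ((n\<^sup>2 + 0) + (3 * n + (card ({..<n} - S) - 1) * (n\<^sup>2 + 3 * n)))"
        unfolding eq by (rule all_runs_bind[OF Q]) (use R in auto)
      then show ?thesis by (rule all_runs_mono) (auto simp: k)
    qed
  qed
qed

text \<open>The factor 2 is due to the exceptional values 56 > 49 at \<open>n = 7\<close> and 112 >
  64 at \<open>n = 8\<close>.\<close>

lemma \<mu>_le: "\<mu> n \<le> 2 * n\<^sup>2"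
  by (auto simp: \<mu>_def)

text \<open>The factor 3 is due to the exceptional value 21 > 16 at \<open>n = 8\<close>.\<close>

lemma \<mu>'_le: "\<mu>' n \<le> 3 * n"
  by (auto simp: \<mu>'_def)

lemma all_runs_is_dynkin_graph_prog:
  assumes "G \<in> carrier_mat n n"
  shows "all_runs (is_dynkin_graph_prog G) (\<lambda>_. True) (2 * n\<^sup>2)"
  unfolding is_dynkin_graph_prog_correct
  by (rule all_runs_Prog) (use assms length_vertex_pairs_le in auto)

lemma all_runs_bigraph_of_prog:
  assumes "A \<in> carrier_mat n n"
  shows "all_runs (bigraph_of_prog A) (\<lambda>G. G \<in> carrier_mat n n) (n\<^sup>2)"
  unfolding bigraph_of_prog_correct[OF assms]
  by (rule all_runs_Prog) (use assms length_vertex_pairs_le in \<open>auto simp: bigraph_of_def\<close>)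

lemma all_runs_pos_def_test_by_inflations:
  assumes "A \<in> carrier_mat n n"
  shows "all_runs (pos_def_test_by_inflations A s) (\<lambda>_. True) (9 * n ^ 4)"
proof -
  have "all_runs (pos_def_test_by_inflations A s) (\<lambda>_. True)
      (n\<^sup>2 + (\<mu> n * (n\<^sup>2 + 2 * n) + 2 * n\<^sup>2))"
    unfolding pos_def_test_by_inflations_def inflations_at_pair_pos_def
    by (intro all_runs_bind[OF all_runs_bigraph_of_prog[OF assms]]
        all_runs_bind[OF _ all_runs_is_dynkin_graph_prog])
      (auto intro: all_runs_inflations_at_pair)
  moreover have "n\<^sup>2 + (\<mu> n * (n\<^sup>2 + 2 * n) + 2 * n\<^sup>2) \<le> 9 * n ^ 4"
  proof -
    have "n \<le> n\<^sup>2" by (simp add: power2_nat_le_imp_le power2_eq_square)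
    then have "\<mu> n * (n\<^sup>2 + 2 * n) \<le> (2 * n\<^sup>2) * (3 * n\<^sup>2)"
      by (intro mult_mono \<mu>_le) auto
    also have "\<dots> = 6 * n ^ 4" by (simp add: power_add[symmetric])
    \<comment> \<open>The constant is 9 = 1 + 6 + 2, by \<open>n\<^sup>2 \<le> n ^ 4\<close>.
      Monotonicity in the exponent requires \<open>n \<ge> 1\<close>, hence the separate case
      \<open>n = 0\<close>.\<close>
    finally show ?thesis using power_increasing[of 2 4 n] by (cases "n = 0") auto
  qed
  ultimately show ?thesis by (auto elim: all_runs_mono)
qed

lemma all_runs_pos_def_test_by_root_inflations:
  assumes "A \<in> carrier_mat n n"
  shows "all_runs (pos_def_test_by_root_inflations A s) (\<lambda>_. True) (16 * n ^ 3)"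
proof -
  let ?C = "\<lambda>H. H \<in> carrier_mat n n"
  have le: "n \<le> n\<^sup>2" by (simp add: power2_nat_le_imp_le power2_eq_square)
  have root: "all_runs (root_loop n {0} G) ?C (4 * n ^ 3)" if "?C G" for G
  proof (rule all_runs_mono[OF all_runs_root_loop[OF that]])
    have "card ({..<n} - {0}) * (n\<^sup>2 + 3 * n) \<le> n * (4 * n\<^sup>2)"
      using le card_mono[of "{..<n}" "{..<n} - {0}"] by (intro mult_mono) auto
    then show "card ({..<n} - {0}) * (n\<^sup>2 + 3 * n) \<le> 4 * n ^ 3"
      by (simp add: power2_eq_square power3_eq_cube)
  qed
  have "all_runs (pos_def_test_by_root_inflations A s) (\<lambda>_. True)
      (n\<^sup>2 + (4 * n ^ 3 + (\<mu>' n * (n\<^sup>2 + 2 * n) + 2 * n\<^sup>2)))"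
    unfolding pos_def_test_by_root_inflations_def inflations_at_pair_poss_def
      inflations_to_pos_sincere_root_def
  proof (rule all_runs_bind[OF all_runs_bigraph_of_prog[OF assms]], rule all_runs_bind)
    show "all_runs (root_loop (dim_row G) {0} G) ?C (4 * n ^ 3)" if "?C G" for G
      using root[OF that] that by auto
    show "all_runs (bind_prog (inflations_at_pair s (\<mu>' (dim_row H)) H) is_dynkin_graph_prog)
        (\<lambda>_. True) (\<mu>' n * (n\<^sup>2 + 2 * n) + 2 * n\<^sup>2)" if "?C H" for H
      using that
      by (intro all_runs_bind[OF _ all_runs_is_dynkin_graph_prog])
        (auto intro: all_runs_inflations_at_pair)
  qed
  moreover have "n\<^sup>2 + (4 * n ^ 3 + (\<mu>' n * (n\<^sup>2 + 2 * n) + 2 * n\<^sup>2)) \<le> 16 * n ^ 3"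
  proof -
    have "\<mu>' n * (n\<^sup>2 + 2 * n) \<le> (3 * n) * (3 * n\<^sup>2)"
      using le by (intro mult_mono \<mu>'_le) auto
    also have "\<dots> = 9 * n ^ 3" by (simp add: power2_eq_square power3_eq_cube)
    \<comment> \<open>The constant is 16 = 1 + 4 + 9 + 2: input, root computation, inflations and
      Dynkin test.\<close>
    finally show ?thesis using power_increasing[of 2 3 n] by (cases "n = 0") auto
  qed
  ultimately show ?thesis by (auto elim: all_runs_mono)
qed

lemma pessimistic_complexity_le:
  assumes "\<And>A. A \<in> carrier_mat n n \<Longrightarrow> all_runs (alg A) P k"
  shows "pessimistic_complexity alg n \<le> enat k"
  unfolding pessimistic_complexity_def
  by (intro SUP_least) (use assms in \<open>fastforce simp: all_runs_def\<close>)

text \<open>Finiteness accompanies the growth bound because \<open>the_enat\<close> is unspecified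
  at \<infinity>, so the bound alone would not say that the complexity is finite.\<close>

lemma enat_polynomially_bounded:
  fixes f :: "nat \<Rightarrow> enat"
  assumes "\<And>n. f n \<le> enat (c * n ^ k)"
  shows "(\<forall>n\<ge>1. f n < \<infinity>) \<and> (\<lambda>n. real (the_enat (f n))) \<in> O(\<lambda>n. real n ^ k)"
proof
  show "\<forall>n\<ge>1. f n < \<infinity>"
    using assms by (metis enat_ord_simps(4) infinity_ileE)
  show "(\<lambda>n. real (the_enat (f n))) \<in> O(\<lambda>n. real n ^ k)"
  \<comment> \<open>The Landau constant must be positive, while \<open>c\<close> may be 0; hence
    \<open>Suc c\<close>.\<close>
  proof (rule landau_o.bigI[of "real (Suc c)"])
    have "real (the_enat (f n)) \<le> real (Suc c) * real n ^ k" for n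
    proof -
      obtain m where m: "f n = enat m" using assms[of n] by (cases "f n") auto
      then have "m \<le> Suc c * n ^ k" using assms[of n] by simp
      then show ?thesis unfolding m the_enat.simps by (metis of_nat_le_iff of_nat_mult of_nat_power)
    qed
    then show "\<forall>\<^sub>F n in at_top. norm (real (the_enat (f n))) \<le> real (Suc c) * norm (real n ^ k)"
      by simp
  qed simp
qed

theorem theorem5p5:
  fixes s :: nat
  assumes "s \<in> {0, 1, 2, 3}"
  shows
    "((\<forall>n\<ge>1. pessimistic_complexity (\<lambda>A. pos_def_test_by_inflations A s) n < \<infinity>) \<and>
      (\<lambda>n. real (the_enat (pessimistic_complexity (\<lambda>A. pos_def_test_by_inflations A s) n)))
        \<in> O(\<lambda>n. real n ^ 4)) \<and>
     ((\<forall>n\<ge>1. pessimistic_complexity (\<lambda>A. pos_def_test_by_root_inflations A s) n < \<infinity>) \<and>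
      (\<lambda>n. real (the_enat (pessimistic_complexity (\<lambda>A. pos_def_test_by_root_inflations A s) n)))
        \<in> O(\<lambda>n. real n ^ 3))"
  using enat_polynomially_bounded[OF pessimistic_complexity_le[OF all_runs_pos_def_test_by_inflations]]
    enat_polynomially_bounded[OF pessimistic_complexity_le[OF all_runs_pos_def_test_by_root_inflations]]
  by (rule conjI)

end
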